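(* For every set $\Gamma$ of infons and every infon $\varphi$ of $\mathbf{P}[\bot_w]$: $\Gamma\vdash\varphi$ in $\mathbf{P}[\bot_w]$ if and only if $\Gamma^*\vdash\varphi^*$ in $\mathbf{P}[\vee^+]$, where the translation $*$ is defined by $q^*=q$ for $q\in At\cup\{\top,\bot\}$, $(\varphi\wedge\psi)^*=\varphi^*\wedge\psi^*$, $(\varphi\to\psi)^*=(\bot\vee^+\varphi^* )\to\psi^*$, and $\Gamma^*=\{\psi^*:\psi\in\Gamma\}$.
   Context: Fix a set $At$ of atomic infons. Infons of $\mathbf{P}[\bot_w]$ are generated by $\varphi ::= \top\mid\bot \mid At \mid (\varphi\wedge\varphi)\mid(\varphi\to\varphi)$. In $\mathbf{P}[\bot_w]$, $\Gamma\vdash\varphi$ iff there is a finite sequence ending in $\varphi$ whose members are in $\Gamma\cup\{\top\}$ or follow from earlier members by the rules: from $\varphi_1,\varphi_2$ infer $\varphi_1\wedge\varphi_2$; from $\varphi_1\wedge\varphi_2$ infer $\varphi_i$ ($i=1,2$); from $\varphi_2$ infer $\varphi_1\to\varphi_2$ (any $\varphi_1$); from $\varphi_1$ and $\varphi_1\to\varphi_2$ infer $\varphi_2$; from $\bot$ and $\varphi\to\psi$ infer $\psi$. $\mathbf{P}[\vee^+]$ (primal disjunction): formulas are generated by $\varphi ::= \top\mid\bot \mid At \mid (\varphi\wedge\varphi)\mid(\varphi\to\varphi)\mid(\varphi\vee^+\varphi)$, where $\bot$ is an ordinary atom with no special rule. $\Gamma\vdash\varphi$ in $\mathbf{P}[\vee^+]$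 iff there is a finite sequence ending in $\varphi$ whose members are in $\Gamma\cup\{\top\}$ or follow from earlier members by the rules: from $\varphi_1,\varphi_2$ infer $\varphi_1\wedge\varphi_2$; from $\varphi_1\wedge\varphi_2$ infer $\varphi_i$; from $\varphi_2$ infer $\varphi_1\to\varphi_2$; from $\varphi_1$ and $\varphi_1\to\varphi_2$ infer $\varphi_2$; from $\varphi_i$ infer $\varphi_1\vee^+\varphi_2$ ($i=1,2$, any other disjunct). There is no elimination rule for $\vee^+$. *)

theory Defs
  imports Main
begin

text \<open>
  Subscript \<open>w\<close>: primal logic with weak falsity, P[\<open>\<bottom>\<^sub>w\<close>].
  Subscript \<open>d\<close>: primal logic with introduction-only disjunction, P[\<open>\<or>\<^sup>+\<close>].
  The type \<open>'a\<close> is the set of atomic infons.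
\<close>

datatype 'a infon =
    Top (\<open>\<top>\<^sub>w\<close>)
  | Bot (\<open>\<bottom>\<^sub>w\<close>)
  | Atom 'a
  | Conj "'a infon" "'a infon" (infixr \<open>\<and>\<^sub>w\<close> 75)
  | Imp "'a infon" "'a infon" (infixr \<open>\<rightarrow>\<^sub>w\<close> 70)

datatype 'a dinfon =
    DTop (\<open>\<top>\<^sub>d\<close>)
  | DBot (\<open>\<bottom>\<^sub>d\<close>)
  | DAtom 'a
  | DConj "'a dinfon" "'a dinfon" (infixr \<open>\<and>\<^sub>d\<close> 75)
  | DImp "'a dinfon" "'a dinfon" (infixr \<open>\<rightarrow>\<^sub>d\<close> 70)
  | DDisj "'a dinfon" "'a dinfon" (infixr \<open>\<or>\<^sub>d\<close> 73)

text \<open>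
  \<open>w_step \<Gamma> E \<phi>\<close>: \<open>\<phi>\<close> may be written as the next member of a derivation from \<open>\<Gamma>\<close>
  whose earlier members form the set \<open>E\<close>; likewise \<open>d_step\<close>. No rule is recursive:
  closure under the rules comes only from the sequences below.
\<close>

inductive w_step :: "'a infon set \<Rightarrow> 'a infon set \<Rightarrow> 'a infon \<Rightarrow> bool"
  for \<Gamma> E :: "'a infon set" where
  hyp: "\<phi> \<in> \<Gamma> \<Longrightarrow> w_step \<Gamma> E \<phi>"
| top: "w_step \<Gamma> E \<top>\<^sub>w"
| conj_intro: "\<lbrakk>\<phi>1 \<in> E; \<phi>2 \<in> E\<rbrakk> \<Longrightarrow> w_step \<Gamma> E (\<phi>1 \<and>\<^sub>w \<phi>2)"
| conj_elim1: "\<phi>1 \<and>\<^sub>w \<phi>2 \<in> E \<Longrightarrow> w_step \<Gamma> E \<phi>1"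
| conj_elim2: "\<phi>1 \<and>\<^sub>w \<phi>2 \<in> E \<Longrightarrow> w_step \<Gamma> E \<phi>2"
| imp_intro: "\<phi>2 \<in> E \<Longrightarrow> w_step \<Gamma> E (\<phi>1 \<rightarrow>\<^sub>w \<phi>2)"
| imp_elim: "\<lbrakk>\<phi>1 \<in> E; \<phi>1 \<rightarrow>\<^sub>w \<phi>2 \<in> E\<rbrakk> \<Longrightarrow> w_step \<Gamma> E \<phi>2"
| bot_elim: "\<lbrakk>\<bottom>\<^sub>w \<in> E; \<phi> \<rightarrow>\<^sub>w \<psi> \<in> E\<rbrakk> \<Longrightarrow> w_step \<Gamma> E \<psi>"

inductive d_step :: "'a dinfon set \<Rightarrow> 'a dinfon set \<Rightarrow> 'a dinfon \<Rightarrow> bool"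
  for \<Gamma> E :: "'a dinfon set" where
  hyp: "\<phi> \<in> \<Gamma> \<Longrightarrow> d_step \<Gamma> E \<phi>"
| top: "d_step \<Gamma> E \<top>\<^sub>d"
| conj_intro: "\<lbrakk>\<phi>1 \<in> E; \<phi>2 \<in> E\<rbrakk> \<Longrightarrow> d_step \<Gamma> E (\<phi>1 \<and>\<^sub>d \<phi>2)"
| conj_elim1: "\<phi>1 \<and>\<^sub>d \<phi>2 \<in> E \<Longrightarrow> d_step \<Gamma> E \<phi>1"
| conj_elim2: "\<phi>1 \<and>\<^sub>d \<phi>2 \<in> E \<Longrightarrow> d_step \<Gamma> E \<phi>2"
| imp_intro: "\<phi>2 \<in> E \<Longrightarrow> d_step \<Gamma> E (\<phi>1 \<rightarrow>\<^sub>d \<phi>2)"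
| imp_elim: "\<lbrakk>\<phi>1 \<in> E; \<phi>1 \<rightarrow>\<^sub>d \<phi>2 \<in> E\<rbrakk> \<Longrightarrow> d_step \<Gamma> E \<phi>2"
| disj_intro1: "\<phi>1 \<in> E \<Longrightarrow> d_step \<Gamma> E (\<phi>1 \<or>\<^sub>d \<phi>2)"
| disj_intro2: "\<phi>2 \<in> E \<Longrightarrow> d_step \<Gamma> E (\<phi>1 \<or>\<^sub>d \<phi>2)"

definition w_derives :: "'a infon set \<Rightarrow> 'a infon \<Rightarrow> bool" (infix \<open>\<turnstile>\<^sub>w\<close> 50) where
  "\<Gamma> \<turnstile>\<^sub>w \<phi> \<longleftrightarrow>
    (\<exists>s. s \<noteq> [] \<and> last s = \<phi> \<and> (\<forall>i<length s. w_step \<Gamma> (set (take i s)) (s ! i)))"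

definition d_derives :: "'a dinfon set \<Rightarrow> 'a dinfon \<Rightarrow> bool" (infix \<open>\<turnstile>\<^sub>d\<close> 50) where
  "\<Gamma> \<turnstile>\<^sub>d \<phi> \<longleftrightarrow>
    (\<exists>s. s \<noteq> [] \<and> last s = \<phi> \<and> (\<forall>i<length s. d_step \<Gamma> (set (take i s)) (s ! i)))"

primrec star :: "'a infon \<Rightarrow> 'a dinfon" where
  "star \<top>\<^sub>w = \<top>\<^sub>d"
| "star \<bottom>\<^sub>w = \<bottom>\<^sub>d"
| "star (Atom q) = DAtom q"
| "star (\<phi> \<and>\<^sub>w \<psi>) = star \<phi> \<and>\<^sub>d star \<psi>"
| "star (\<phi> \<rightarrow>\<^sub>w \<psi>) = (\<bottom>\<^sub>d \<or>\<^sub>d star \<phi>) \<rightarrow>\<^sub>d star \<psi>"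

end

theory Submission
  imports Defs
begin

text \<open>
  From left to right, every rule of P[\<open>\<bottom>\<^sub>w\<close>] is simulated: either \<open>\<bottom>\<close> or \<open>\<phi>\<^sup>*\<close> yields
  \<open>\<bottom> \<or>\<^sup>+ \<phi>\<^sup>*\<close>, which then triggers \<open>(\<phi> \<rightarrow> \<psi>)\<^sup>*\<close>. From right to left, take the two-valued
  model of P[\<open>\<or>\<^sup>+\<close>] that makes exactly the derivable atoms true (\<open>\<bottom>\<close> counting as an atom), reads
  \<open>\<and>\<close>, \<open>\<or>\<^sup>+\<close> truth-functionally and makes an implication with true antecedent
  and false consequent false, one with true consequent true, and one with both sides false true
  iff it is the translation of an infon derivable from \<open>\<Gamma>\<close>. All rules are sound in it, and a translation \<open>\<phi>\<^sup>*\<close> is true exactly when \<open>\<Gamma> \<turnstile> \<phi>\<close>.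
\<close>

text \<open>Abstracting from the step relation lets the bookkeeping with sequences be done once for
  both calculi.\<close>

definition derivable :: "('b set \<Rightarrow> 'b \<Rightarrow> bool) \<Rightarrow> 'b \<Rightarrow> bool" where
  "derivable step x \<longleftrightarrow>
    (\<exists>s. s \<noteq> [] \<and> last s = x \<and> (\<forall>i<length s. step (set (take i s)) (s ! i)))"

text \<open>Strong induction on the position in the sequence; afterwards derivations can be treated
  by rule induction, without indices.\<close>

lemma derivable_induct [consumes 1, case_names step]:
  assumes "derivable step x"
    and closed: "\<And>E y. E \<subseteq> {z. P z} \<Longrightarrow> step E y \<Longrightarrow> P y"
  shows "P x"
proof -
  obtain s where s: "s \<noteq> []" "last s = x" "\<forall>i<length s. step (set (take i s)) (s ! i)"
    using assms(1) unfolding derivable_def by blast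
  have "i < length s \<Longrightarrow> P (s ! i)" for i
  proof (induction i rule: less_induct)
    case (less i)
    have "set (take i s) \<subseteq> {z. P z}"
      using less by (auto simp: in_set_conv_nth)
    with less.prems s(3) closed show ?case by blast
  qed
  with s(1,2) show ?thesis
    by (metis last_conv_nth length_greater_0_conv diff_less zero_less_one)
qed

text \<open>Derivations of the finitely many premises are concatenated and \<open>x\<close> is
  appended. Monotonicity keeps each step valid after its prefix has grown.\<close>

lemma derivable_step:
  assumes mono: "\<And>E F y. E \<subseteq> F \<Longrightarrow> step E y \<Longrightarrow> step F y"
    and "finite E" "\<And>y. y \<in> E \<Longrightarrow> derivable step y" "step E x"
  shows "derivable step x"
proof -
  \<comment> \<open>Nonemptiness is left out here, so that \<open>[]\<close> serves for a rule
    without premises.\<close>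
  let ?ok = "\<lambda>s. \<forall>i<length s. step (set (take i s)) (s ! i)"
  have "\<exists>s. E \<subseteq> set s \<and> ?ok s"
    using assms(2,3)
  proof (induction E)
    case empty
    show ?case by (rule exI[of _ "[]"]) simp
  next
    case (insert y E)
    then obtain s where s: "E \<subseteq> set s" "?ok s" by auto
    obtain t where t: "t \<noteq> []" "last t = y" "?ok t"
      using insert.prems unfolding derivable_def by blast
    have "step (set (take i (s @ t))) ((s @ t) ! i)" if "i < length (s @ t)" for i
    proof (cases "i < length s")
      case True
      with s(2) show ?thesis by (simp add: nth_append)
    next
      case False
      with that t(3) have "step (set (take (i - length s) t)) (t ! (i - length s))" by simp
      \<comment> \<open>Inside \<open>t\<close>, the earlier members are those in the old prefix of
        \<open>t\<close> together with all of \<open>s\<close>.\<close>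
      with False show ?thesis
        by (auto simp: nth_append intro: mono[rotated])
    qed
    moreover have "insert y E \<subseteq> set (s @ t)"
      using s(1) t(1,2) by auto
    ultimately show ?case by blast
  qed
  then obtain s where s: "E \<subseteq> set s" "?ok s" by blast
  have "?ok (s @ [x])"
    using s mono[OF s(1) assms(4)] by (auto simp: nth_append less_Suc_eq)
  then show ?thesis
    unfolding derivable_def by (intro exI[of _ "s @ [x]"]) simp
qed

lemma w_derives_derivable: "\<Gamma> \<turnstile>\<^sub>w \<phi> \<longleftrightarrow> derivable (w_step \<Gamma>) \<phi>"
  unfolding w_derives_def derivable_def ..

lemma d_derives_derivable: "\<Gamma> \<turnstile>\<^sub>d \<phi> \<longleftrightarrow> derivable (d_step \<Gamma>) \<phi>"
  unfolding d_derives_def derivable_def ..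

lemma w_step_mono: "E \<subseteq> F \<Longrightarrow> w_step \<Gamma> E \<phi> \<Longrightarrow> w_step \<Gamma> F \<phi>"
  by (erule w_step.cases) (auto intro: w_step.intros)

lemma d_step_mono: "E \<subseteq> F \<Longrightarrow> d_step \<Gamma> E \<phi> \<Longrightarrow> d_step \<Gamma> F \<phi>"
  by (erule d_step.cases) (auto intro: d_step.intros)

lemma w_derives_step:
  assumes "w_step \<Gamma> E \<phi>" "finite E" "\<forall>\<psi>\<in>E. \<Gamma> \<turnstile>\<^sub>w \<psi>"
  shows "\<Gamma> \<turnstile>\<^sub>w \<phi>"
  using assms derivable_step[of "w_step \<Gamma>" E \<phi>] w_step_mono
  unfolding w_derives_derivable by blast

lemma d_derives_step:
  assumes "d_step \<Gamma> E \<phi>" "finite E" "\<forall>\<psi>\<in>E. \<Gamma> \<turnstile>\<^sub>d \<psi>"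
  shows "\<Gamma> \<turnstile>\<^sub>d \<phi>"
  using assms derivable_step[of "d_step \<Gamma>" E \<phi>] d_step_mono
  unfolding d_derives_derivable by blast

lemma w_derives_rules:
  "\<phi> \<in> \<Gamma> \<Longrightarrow> \<Gamma> \<turnstile>\<^sub>w \<phi>"
  "\<Gamma> \<turnstile>\<^sub>w \<top>\<^sub>w"
  "\<Gamma> \<turnstile>\<^sub>w \<phi> \<Longrightarrow> \<Gamma> \<turnstile>\<^sub>w \<psi> \<Longrightarrow> \<Gamma> \<turnstile>\<^sub>w \<phi> \<and>\<^sub>w \<psi>"
  "\<Gamma> \<turnstile>\<^sub>w \<phi> \<and>\<^sub>w \<psi> \<Longrightarrow> \<Gamma> \<turnstile>\<^sub>w \<phi>"
  "\<Gamma> \<turnstile>\<^sub>w \<phi> \<and>\<^sub>w \<psi> \<Longrightarrow> \<Gamma> \<turnstile>\<^sub>w \<psi>"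
  "\<Gamma> \<turnstile>\<^sub>w \<psi> \<Longrightarrow> \<Gamma> \<turnstile>\<^sub>w \<phi> \<rightarrow>\<^sub>w \<psi>"
  "\<Gamma> \<turnstile>\<^sub>w \<phi> \<Longrightarrow> \<Gamma> \<turnstile>\<^sub>w \<phi> \<rightarrow>\<^sub>w \<psi> \<Longrightarrow> \<Gamma> \<turnstile>\<^sub>w \<psi>"
  "\<Gamma> \<turnstile>\<^sub>w \<bottom>\<^sub>w \<Longrightarrow> \<Gamma> \<turnstile>\<^sub>w \<phi> \<rightarrow>\<^sub>w \<psi> \<Longrightarrow> \<Gamma> \<turnstile>\<^sub>w \<psi>"
  subgoal by (rule w_derives_step[OF w_step.hyp[where E = "{}"]]) simp_all
  subgoal by (rule w_derives_step[OF w_step.top[where E = "{}"]]) simp_all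
  subgoal by (rule w_derives_step[OF w_step.conj_intro[where E = "{\<phi>, \<psi>}"]]) simp_all
  subgoal by (rule w_derives_step[OF w_step.conj_elim1[where E = "{\<phi> \<and>\<^sub>w \<psi>}"]]) simp_all
  subgoal by (rule w_derives_step[OF w_step.conj_elim2[where E = "{\<phi> \<and>\<^sub>w \<psi>}"]]) simp_all
  subgoal by (rule w_derives_step[OF w_step.imp_intro[where E = "{\<psi>}"]]) simp_all
  subgoal by (rule w_derives_step[OF w_step.imp_elim[where ?\<phi>1.0 = \<phi> and E = "{\<phi>, \<phi> \<rightarrow>\<^sub>w \<psi>}"]]) simp_all
  subgoal by (rule w_derives_step[OF w_step.bot_elim[where E = "{\<bottom>\<^sub>w, \<phi> \<rightarrow>\<^sub>w \<psi>}"]]) simp_all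
  done

lemma d_derives_rules:
  "\<phi> \<in> \<Gamma> \<Longrightarrow> \<Gamma> \<turnstile>\<^sub>d \<phi>"
  "\<Gamma> \<turnstile>\<^sub>d \<top>\<^sub>d"
  "\<Gamma> \<turnstile>\<^sub>d \<phi> \<Longrightarrow> \<Gamma> \<turnstile>\<^sub>d \<psi> \<Longrightarrow> \<Gamma> \<turnstile>\<^sub>d \<phi> \<and>\<^sub>d \<psi>"
  "\<Gamma> \<turnstile>\<^sub>d \<phi> \<and>\<^sub>d \<psi> \<Longrightarrow> \<Gamma> \<turnstile>\<^sub>d \<phi>"
  "\<Gamma> \<turnstile>\<^sub>d \<phi> \<and>\<^sub>d \<psi> \<Longrightarrow> \<Gamma> \<turnstile>\<^sub>d \<psi>"
  "\<Gamma> \<turnstile>\<^sub>d \<psi> \<Longrightarrow> \<Gamma> \<turnstile>\<^sub>d \<phi> \<rightarrow>\<^sub>d \<psi>"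
  "\<Gamma> \<turnstile>\<^sub>d \<phi> \<Longrightarrow> \<Gamma> \<turnstile>\<^sub>d \<phi> \<rightarrow>\<^sub>d \<psi> \<Longrightarrow> \<Gamma> \<turnstile>\<^sub>d \<psi>"
  "\<Gamma> \<turnstile>\<^sub>d \<phi> \<Longrightarrow> \<Gamma> \<turnstile>\<^sub>d \<phi> \<or>\<^sub>d \<psi>"
  "\<Gamma> \<turnstile>\<^sub>d \<psi> \<Longrightarrow> \<Gamma> \<turnstile>\<^sub>d \<phi> \<or>\<^sub>d \<psi>"
  subgoal by (rule d_derives_step[OF d_step.hyp[where E = "{}"]]) simp_all
  subgoal by (rule d_derives_step[OF d_step.top[where E = "{}"]]) simp_all
  subgoal by (rule d_derives_step[OF d_step.conj_intro[where E = "{\<phi>, \<psi>}"]]) simp_all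
  subgoal by (rule d_derives_step[OF d_step.conj_elim1[where E = "{\<phi> \<and>\<^sub>d \<psi>}"]]) simp_all
  subgoal by (rule d_derives_step[OF d_step.conj_elim2[where E = "{\<phi> \<and>\<^sub>d \<psi>}"]]) simp_all
  subgoal by (rule d_derives_step[OF d_step.imp_intro[where E = "{\<psi>}"]]) simp_all
  subgoal by (rule d_derives_step[OF d_step.imp_elim[where ?\<phi>1.0 = \<phi> and E = "{\<phi>, \<phi> \<rightarrow>\<^sub>d \<psi>}"]]) simp_all
  subgoal by (rule d_derives_step[OF d_step.disj_intro1[where E = "{\<phi>}"]]) simp_all
  subgoal by (rule d_derives_step[OF d_step.disj_intro2[where E = "{\<psi>}"]]) simp_all
  done

lemma w_derives_imp_d_derives:
  assumes "\<Gamma> \<turnstile>\<^sub>w \<phi>"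
  shows "star ` \<Gamma> \<turnstile>\<^sub>d star \<phi>"
  using assms unfolding w_derives_derivable
proof (induction rule: derivable_induct)
  case (step E y)
  have IH: "star ` \<Gamma> \<turnstile>\<^sub>d star \<psi>" if "\<psi> \<in> E" for \<psi>
    using step(1) that by blast
  from step(2) show ?case
  proof cases
    case hyp
    then show ?thesis by (simp add: d_derives_rules(1))
  next
    case top
    then show ?thesis by (simp add: d_derives_rules(2))
  next
    case (conj_intro \<phi>1 \<phi>2)
    then show ?thesis by (simp add: IH d_derives_rules(3))
  next
    case (conj_elim1 \<phi>2)
    from IH[OF this] show ?thesis by (auto intro: d_derives_rules(4))
  next
    case (conj_elim2 \<phi>1)
    from IH[OF this] show ?thesis by (auto intro: d_derives_rules(5))
  next
    case (imp_intro \<phi>2 \<phi>1)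
    then show ?thesis by (simp add: IH d_derives_rules(6))
  next
    case (imp_elim \<phi>1)
    from IH[OF imp_elim(1)] IH[OF imp_elim(2)] show ?thesis
      by (auto intro: d_derives_rules(7) d_derives_rules(9))
  next
    case (bot_elim \<phi>)
    from IH[OF bot_elim(1)] IH[OF bot_elim(2)] show ?thesis
      by (auto intro: d_derives_rules(7) d_derives_rules(8))
  qed
qed

text \<open>The outermost connective survives translation, and the added disjunct \<bottom> can be
  stripped off again. Hence \<open>star \<phi>\<close> lies in the image of a set only if \<phi>
  lies in the set itself.\<close>

lemma star_eq_iff: "star \<phi> = star \<psi> \<longleftrightarrow> \<phi> = \<psi>"
proof (induction \<phi> arbitrary: \<psi>)
  case Top
  show ?case by (cases \<psi>) auto
next
  case Bot
  show ?case by (cases \<psi>) auto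
next
  case (Atom q)
  show ?case by (cases \<psi>) auto
next
  case (Conj \<phi>1 \<phi>2)
  then show ?case by (cases \<psi>) auto
next
  case (Imp \<phi>1 \<phi>2)
  then show ?case by (cases \<psi>) auto
qed

text \<open>\<open>D\<close> fixes the truth of atoms and serves as an oracle for implications whose
  two sides are false. It will be the set of translations of derivable infons.\<close>

primrec holds :: "'a dinfon set \<Rightarrow> 'a dinfon \<Rightarrow> bool" where
  "holds D \<top>\<^sub>d \<longleftrightarrow> True"
| "holds D \<bottom>\<^sub>d \<longleftrightarrow> \<bottom>\<^sub>d \<in> D"
| "holds D (DAtom q) \<longleftrightarrow> DAtom q \<in> D"
| "holds D (a \<and>\<^sub>d b) \<longleftrightarrow> holds D a \<and> holds D b"
| "holds D (a \<rightarrow>\<^sub>d b) \<longleftrightarrow> holds D b \<or> (\<not> holds D a \<and> a \<rightarrow>\<^sub>d b \<in> D)"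
| "holds D (a \<or>\<^sub>d b) \<longleftrightarrow> holds D a \<or> holds D b"

text \<open>This works for arbitrary \<open>D\<close>: a true consequent makes an implication true,
  and a true antecedent shuts out the oracle, so detachment is safe.\<close>

lemma d_derives_sound:
  assumes "\<Delta> \<turnstile>\<^sub>d a" "\<And>b. b \<in> \<Delta> \<Longrightarrow> holds D b"
  shows "holds D a"
  using assms(1) unfolding d_derives_derivable
proof (induction rule: derivable_induct)
  case (step E y)
  have IH: "b \<in> E \<Longrightarrow> holds D b" for b
    using step(1) by blast
  from step(2) show ?case
    by cases (use assms(2) in \<open>auto dest!: IH\<close>)
qed

text \<open>The critical case is a derivable implication with true translated antecedent: by
  induction \<bottom> or the original antecedent is derivable, so \<open>bot_elim\<close> or
  \<open>imp_elim\<close> yields the consequent.\<close>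

lemma holds_star_iff: "holds (star ` {\<psi>. \<Gamma> \<turnstile>\<^sub>w \<psi>}) (star \<phi>) \<longleftrightarrow> \<Gamma> \<turnstile>\<^sub>w \<phi>"
proof -
  have mem: "star \<phi> \<in> star ` {\<psi>. \<Gamma> \<turnstile>\<^sub>w \<psi>} \<longleftrightarrow> \<Gamma> \<turnstile>\<^sub>w \<phi>" for \<phi>
    by (auto simp: star_eq_iff)
  \<comment> \<open>These are the shapes for which \<open>holds\<close> consults \<open>D\<close>.
    They are stated with \<open>star\<close> unfolded, as the simplifier will meet them.\<close>
  note mem_simps = mem[of \<open>\<bottom>\<^sub>w\<close>, simplified] mem[of "Atom q" for q, simplified]
    mem[of "\<alpha> \<rightarrow>\<^sub>w \<beta>" for \<alpha> \<beta>, simplified]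
  show ?thesis
    by (induction \<phi>) (auto simp: mem_simps intro: w_derives_rules)
qed

theorem theorem6:
  fixes \<Gamma> :: "'a infon set" and \<phi> :: "'a infon"
  shows "\<Gamma> \<turnstile>\<^sub>w \<phi> \<longleftrightarrow> star ` \<Gamma> \<turnstile>\<^sub>d star \<phi>"
proof
  assume "star ` \<Gamma> \<turnstile>\<^sub>d star \<phi>"
  then have "holds (star ` {\<psi>. \<Gamma> \<turnstile>\<^sub>w \<psi>}) (star \<phi>)"
    by (rule d_derives_sound) (auto simp: holds_star_iff intro: w_derives_rules(1))
  then show "\<Gamma> \<turnstile>\<^sub>w \<phi>" by (simp add: holds_star_iff)
qed (rule w_derives_imp_d_derives)

end
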